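(* Let $k$ be a commutative ring and let $(A,\star,\alpha,c)$ be a left weakly unital hom-associative $k$-algebra with weak left unit $c\in A$ and with $\alpha$ bijective. Then there exists a $k$-bilinear multiplication $\cdot:A\times A\to A$ such that $(A,\cdot,c)$ is a left unital associative algebra (i.e. $\cdot$ is associative and $c\cdot x=x$ for all $x\in A$) and such that $(A,\star,\alpha,c)$ arises from $(A,\cdot,c)$ by the generalized Yau twisting procedure; that is, $\alpha$ satisfies $\alpha(\alpha(x)\cdot\alpha(y\cdot z))=\alpha(\alpha(x\cdot y)\cdot\alpha(z))$ for all $x,y,z\in A$, and $x\star y=\alpha(x\cdot y)$ for all $x,y\in A$.
   Context: A hom-associative $k$-algebra $(A,\star,\alpha)$ is a $k$-module $A$ with a $k$-bilinear, not necessarily associative, product $\star$ and a $k$-linear map $\alpha:A\to A$ (the twisting map, not assumed multiplicative) such that $\alpha(x)\star(y\star z)=(x\star y)\star\alpha(z)$ for all $x,y,z\in A$. It is left weakly unital with weak left unit $c\in A$ if $\alpha(x)=c\star x$ for all $x\in A$. Generalized Yau twisting procedure: given a $k$-algebra $(A,\cdot)$, not necessarily associative, and a $k$-linear map $\alpha:A\to A$ satisfying $\alpha(\alpha(x)\cdot\alpha(y\cdot z))=\alpha(\alpha(x\cdot y)\cdot\alpha(z))$ for all $x,y,z\in A$, one sets $x\star y:=\alpha(x\cdot y)$. Then $(A,\star,\alpha)$ is a hom-associative $k$-algebra, and a left unit of $(A,\cdot)$ is a weak left unit of $(A,\star,\alpha)$. *)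

theory Defs
  imports "HOL-Algebra.Module"
begin

text \<open>
  The module record also has fields for a product and a unit, but the locale \<open>module\<close> leaves them
  unconstrained for the second structure. They are ignored here; products on the module \<open>A\<close> are
  separate functions, since several products on the same module have to be compared.
\<close>

definition linear_endo ::
  "('r, 'm) ring_scheme \<Rightarrow> ('r, 'a, 'n) module_scheme \<Rightarrow> ('a \<Rightarrow> 'a) \<Rightarrow> bool"
  where "linear_endo k A f \<longleftrightarrow>
    f \<in> carrier A \<rightarrow> carrier A \<and>
    (\<forall>x\<in>carrier A. \<forall>y\<in>carrier A. f (x \<oplus>\<^bsub>A\<^esub> y) = f x \<oplus>\<^bsub>A\<^esub> f y) \<and>
    (\<forall>r\<in>carrier k. \<forall>x\<in>carrier A. f (r \<odot>\<^bsub>A\<^esub> x) = r \<odot>\<^bsub>A\<^esub> f x)"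

definition bilinear_product ::
  "('r, 'm) ring_scheme \<Rightarrow> ('r, 'a, 'n) module_scheme \<Rightarrow> ('a \<Rightarrow> 'a \<Rightarrow> 'a) \<Rightarrow> bool"
  where "bilinear_product k A p \<longleftrightarrow>
    (\<forall>x\<in>carrier A. linear_endo k A (\<lambda>y. p x y)) \<and>
    (\<forall>y\<in>carrier A. linear_endo k A (\<lambda>x. p x y))"

locale nonassoc_algebra = module k A
  for k :: "('r, 'm) ring_scheme" and A :: "('r, 'a, 'n) module_scheme" +
  fixes p :: "'a \<Rightarrow> 'a \<Rightarrow> 'a"
  assumes bilinear: "bilinear_product k A p"

locale left_unital_assoc_algebra = nonassoc_algebra k A p
  for k :: "('r, 'm) ring_scheme" and A :: "('r, 'a, 'n) module_scheme"
    and p :: "'a \<Rightarrow> 'a \<Rightarrow> 'a" +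
  fixes c :: 'a
  assumes assoc: "\<lbrakk>x \<in> carrier A; y \<in> carrier A; z \<in> carrier A\<rbrakk> \<Longrightarrow> p x (p y z) = p (p x y) z"
    and unit_closed: "c \<in> carrier A"
    and left_unit: "x \<in> carrier A \<Longrightarrow> p c x = x"

locale hom_assoc_algebra = nonassoc_algebra k A p
  for k :: "('r, 'm) ring_scheme" and A :: "('r, 'a, 'n) module_scheme"
    and p :: "'a \<Rightarrow> 'a \<Rightarrow> 'a" +
  fixes \<alpha> :: "'a \<Rightarrow> 'a"
  assumes twist_linear: "linear_endo k A \<alpha>"
    and hom_assoc: "\<lbrakk>x \<in> carrier A; y \<in> carrier A; z \<in> carrier A\<rbrakk>
      \<Longrightarrow> p (\<alpha> x) (p y z) = p (p x y) (\<alpha> z)"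

locale left_weakly_unital_hom_assoc_algebra = hom_assoc_algebra k A p \<alpha>
  for k :: "('r, 'm) ring_scheme" and A :: "('r, 'a, 'n) module_scheme"
    and p :: "'a \<Rightarrow> 'a \<Rightarrow> 'a" and \<alpha> :: "'a \<Rightarrow> 'a" +
  fixes c :: 'a
  assumes weak_unit_closed: "c \<in> carrier A"
    and weak_left_unit: "x \<in> carrier A \<Longrightarrow> \<alpha> x = p c x"

text \<open>
  \<open>generalized_yau_twist k A p \<alpha> s\<close>: the twisting map \<open>\<alpha>\<close> is admissible for the algebra \<open>(A, p)\<close>, and
  the generalized Yau twisting procedure applied to \<open>(A, p)\<close> and \<open>\<alpha>\<close> yields the product \<open>s\<close>.
  The products are only compared on the carrier.
\<close>

locale generalized_yau_twist = nonassoc_algebra k A p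
  for k :: "('r, 'm) ring_scheme" and A :: "('r, 'a, 'n) module_scheme"
    and p :: "'a \<Rightarrow> 'a \<Rightarrow> 'a" +
  fixes \<alpha> :: "'a \<Rightarrow> 'a" and s :: "'a \<Rightarrow> 'a \<Rightarrow> 'a"
  assumes twist_linear: "linear_endo k A \<alpha>"
    and twist_condition: "\<lbrakk>x \<in> carrier A; y \<in> carrier A; z \<in> carrier A\<rbrakk>
      \<Longrightarrow> \<alpha> (p (\<alpha> x) (\<alpha> (p y z))) = \<alpha> (p (\<alpha> (p x y)) (\<alpha> z))"
    and twisted_product: "\<lbrakk>x \<in> carrier A; y \<in> carrier A\<rbrakk> \<Longrightarrow> s x y = \<alpha> (p x y)"

end

theory Submission
  imports Defs
begin

text \<open>
  Since \<open>\<alpha>\<close> is bijective, \<open>x \<star> y = \<alpha> (x \<cdot> y)\<close> leaves no choice: \<open>x \<cdot> y\<close> must be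
  \<open>\<alpha>\<^sup>-\<^sup>1 (x \<star> y)\<close>. Bilinearity, the left unit and the twist condition are then immediate, and
  everything comes down to associativity. Written with \<open>\<cdot>\<close>, hom-associativity is associativity
  disturbed by \<open>\<alpha>\<close>, namely \<open>\<alpha> x \<cdot> \<alpha> (y \<cdot> z) = \<alpha> (x \<cdot> y) \<cdot> \<alpha> z\<close>.

  The disturbance is removed by comparing \<open>\<cdot>\<close> with its conjugate under \<open>\<alpha>\<close>,
  \<open>x \<bullet> y = \<alpha>\<^sup>-\<^sup>1 (\<alpha> x \<cdot> \<alpha> y)\<close>, which has the left unit \<open>\<alpha>\<^sup>-\<^sup>1 c\<close>. Hom-associativity becomes
  \<open>x \<bullet> (y \<cdot> z) = (x \<cdot> y) \<bullet> z\<close>. A second mixed law, \<open>x \<cdot> (y \<bullet> z) = (x \<cdot> y) \<bullet> z\<close>, is the heart of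
  the proof (\<open>dot_conj\<close>); it rests on the fact that hom-associativity also holds with \<open>\<alpha>\<^sup>2\<close> in
  place of \<open>\<alpha>\<close>. The two laws give \<open>x \<cdot> (c \<bullet> w) = x \<bullet> w\<close>, and every \<open>z\<close> can be written as
  \<open>c \<bullet> w\<close>. Hence
  \<open>(x \<cdot> y) \<cdot> z = (x \<cdot> y) \<bullet> w = x \<cdot> (y \<bullet> w) = x \<cdot> (y \<cdot> z)\<close>.
\<close>

text \<open>
  Associativity is a matter of re-bracketing alone, hence a statement about a set \<open>S\<close> with a
  product. The map \<open>b\<close> is the inverse of the twisting map \<open>a\<close>.
\<close>

locale twisted_associative =
  fixes S :: "'a set" and dot :: "'a \<Rightarrow> 'a \<Rightarrow> 'a" (infixl "\<cdot>" 70)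
    and a b :: "'a \<Rightarrow> 'a" and c :: 'a
  assumes dot_closed [simp]: "\<lbrakk>x \<in> S; y \<in> S\<rbrakk> \<Longrightarrow> x \<cdot> y \<in> S"
    and a_closed [simp]: "x \<in> S \<Longrightarrow> a x \<in> S"
    and b_closed [simp]: "x \<in> S \<Longrightarrow> b x \<in> S"
    and c_closed [simp]: "c \<in> S"
    and a_b [simp]: "x \<in> S \<Longrightarrow> a (b x) = x"
    and b_a [simp]: "x \<in> S \<Longrightarrow> b (a x) = x"
    and c_dot [simp]: "x \<in> S \<Longrightarrow> c \<cdot> x = x"
    and twisted_assoc: "\<lbrakk>x \<in> S; y \<in> S; z \<in> S\<rbrakk> \<Longrightarrow> a x \<cdot> a (y \<cdot> z) = a (x \<cdot> y) \<cdot> a z"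
begin

definition conj_dot :: "'a \<Rightarrow> 'a \<Rightarrow> 'a" (infixl "\<bullet>" 70)
  where "x \<bullet> y = b (a x \<cdot> a y)"

lemma conj_dot_closed [simp]: "\<lbrakk>x \<in> S; y \<in> S\<rbrakk> \<Longrightarrow> x \<bullet> y \<in> S"
  by (simp add: conj_dot_def)

lemma a_conj_dot: "\<lbrakk>x \<in> S; y \<in> S\<rbrakk> \<Longrightarrow> a (x \<bullet> y) = a x \<cdot> a y"
  by (simp add: conj_dot_def)

lemma conj_dot_dot: "\<lbrakk>x \<in> S; y \<in> S; z \<in> S\<rbrakk> \<Longrightarrow> x \<bullet> (y \<cdot> z) = (x \<cdot> y) \<bullet> z"
  by (simp add: conj_dot_def twisted_assoc)

text \<open>
  The instance \<open>x = c\<close> of the twisted law: \<open>a\<close> is multiplicative up to left multiplication by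
  \<open>a c\<close>. This factor depends on neither argument, so it can absorb a further application of
  \<open>a\<close> to both sides of the twisted law.
\<close>

lemma a_almost_multiplicative: "\<lbrakk>x \<in> S; y \<in> S\<rbrakk> \<Longrightarrow> a x \<cdot> a y = a c \<cdot> a (x \<cdot> y)"
  using twisted_assoc[of c x y] by simp

lemma twisted_assoc_square:
  assumes "x \<in> S" "y \<in> S" "z \<in> S"
  shows "a (a x) \<cdot> a (a (y \<cdot> z)) = a (a (x \<cdot> y)) \<cdot> a (a z)"
proof -
  have "a (a x) \<cdot> a (a (y \<cdot> z)) = a c \<cdot> a (a x \<cdot> a (y \<cdot> z))"
    using assms by (intro a_almost_multiplicative) simp_all
  also have "\<dots> = a c \<cdot> a (a (x \<cdot> y) \<cdot> a z)"
    using assms by (simp add: twisted_assoc)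
  also have "\<dots> = a (a (x \<cdot> y)) \<cdot> a (a z)"
    using assms by (intro a_almost_multiplicative [symmetric]) simp_all
  finally show ?thesis .
qed

text \<open>
  The element \<open>a (a (u \<cdot> x)) \<cdot> a (a (y \<bullet> z))\<close> can be re-bracketed in two ways: by the law for
  \<open>a \<circ> a\<close>, or by the law for \<open>a\<close>, used repeatedly. Both results have the left factor
  \<open>a (a u)\<close>, which disappears for a suitable \<open>u\<close>.
\<close>

lemma dot_conj:
  assumes "x \<in> S" "y \<in> S" "z \<in> S"
  shows "x \<cdot> (y \<bullet> z) = (x \<cdot> y) \<bullet> z"
proof -
  define u where "u = b (b c)"
  have u: "u \<in> S" "a (a u) = c"
    by (simp_all add: u_def)
  have "a (a u) \<cdot> a (a (x \<cdot> (y \<bullet> z))) = a (a (u \<cdot> x)) \<cdot> a (a (y \<bullet> z))"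
    using assms u(1) by (simp add: twisted_assoc_square)
  also have "\<dots> = a (a (u \<cdot> x)) \<cdot> a (a y \<cdot> a z)"
    using assms by (simp add: a_conj_dot)
  also have "\<dots> = a (a (u \<cdot> x) \<cdot> a y) \<cdot> a (a z)"
    using assms u(1) by (simp add: twisted_assoc)
  also have "\<dots> = a (a u \<cdot> a (x \<cdot> y)) \<cdot> a (a z)"
    using assms u(1) by (simp add: twisted_assoc)
  also have "\<dots> = a (a u) \<cdot> a (a (x \<cdot> y) \<cdot> a z)"
    using assms u(1) by (simp only: twisted_assoc a_closed dot_closed)
  also have "\<dots> = a (a u) \<cdot> a (a ((x \<cdot> y) \<bullet> z))"
    using assms by (simp add: a_conj_dot)
  finally have "a (a (x \<cdot> (y \<bullet> z))) = a (a ((x \<cdot> y) \<bullet> z))"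
    using assms u(2) by simp
  then have "b (b (a (a (x \<cdot> (y \<bullet> z))))) = b (b (a (a ((x \<cdot> y) \<bullet> z))))"
    by simp
  then show ?thesis
    using assms by simp
qed

lemma dot_c_conj:
  assumes "x \<in> S" "w \<in> S"
  shows "x \<cdot> (c \<bullet> w) = x \<bullet> w"
  using assms dot_conj[of x c w] conj_dot_dot[of x c w] by simp

text \<open>
  The witness comes from the left unit \<open>b c\<close> of \<open>\<bullet>\<close>: the first mixed law moves it into the
  left argument, where it meets \<open>c\<close> as \<open>c \<cdot> b c = b c\<close>.
\<close>

lemma eq_c_conj:
  assumes "z \<in> S"
  shows "z = c \<bullet> (b c \<cdot> z)"
proof -
  have "c \<bullet> (b c \<cdot> z) = b c \<bullet> z"
    using assms by (simp add: conj_dot_dot)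
  also have "\<dots> = z"
    using assms by (simp add: conj_dot_def)
  finally show ?thesis ..
qed

theorem dot_assoc:
  assumes "x \<in> S" "y \<in> S" "z \<in> S"
  shows "x \<cdot> (y \<cdot> z) = (x \<cdot> y) \<cdot> z"
proof -
  obtain w where w: "w \<in> S" "z = c \<bullet> w"
    using assms eq_c_conj[of z] by (metis b_closed c_closed dot_closed)
  have "x \<cdot> (y \<cdot> z) = x \<cdot> (y \<bullet> w)"
    using assms w by (simp add: dot_c_conj)
  also have "\<dots> = (x \<cdot> y) \<bullet> w"
    using assms w by (simp add: dot_conj)
  also have "\<dots> = (x \<cdot> y) \<cdot> z"
    using assms w by (simp add: dot_c_conj)
  finally show ?thesis .
qed

end

lemma linear_endo_comp:
  assumes "linear_endo k A f" "linear_endo k A g"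
  shows "linear_endo k A (\<lambda>x. f (g x))"
  using assms by (auto simp: linear_endo_def Pi_iff)

lemma (in module) linear_endo_inverse:
  assumes "linear_endo R M f"
    and closed: "\<And>x. x \<in> carrier M \<Longrightarrow> g x \<in> carrier M"
    and fg: "\<And>x. x \<in> carrier M \<Longrightarrow> f (g x) = x"
    and gf: "\<And>x. x \<in> carrier M \<Longrightarrow> g (f x) = x"
  shows "linear_endo R M g"
  unfolding linear_endo_def
proof (intro conjI ballI)
  note lin = assms(1)[unfolded linear_endo_def]
  show "g \<in> carrier M \<rightarrow> carrier M"
    using closed by auto
  show "g (x \<oplus>\<^bsub>M\<^esub> y) = g x \<oplus>\<^bsub>M\<^esub> g y" if "x \<in> carrier M" "y \<in> carrier M" for x y
  proof -
    have "f (g x \<oplus>\<^bsub>M\<^esub> g y) = x \<oplus>\<^bsub>M\<^esub> y"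
      using lin that closed fg by simp
    then show ?thesis
      using gf[of "g x \<oplus>\<^bsub>M\<^esub> g y"] that closed by simp
  qed
  show "g (r \<odot>\<^bsub>M\<^esub> x) = r \<odot>\<^bsub>M\<^esub> g x" if "r \<in> carrier R" "x \<in> carrier M" for r x
  proof -
    have "f (r \<odot>\<^bsub>M\<^esub> g x) = r \<odot>\<^bsub>M\<^esub> x"
      using lin that closed fg by simp
    then show ?thesis
      using gf[of "r \<odot>\<^bsub>M\<^esub> g x"] that closed by simp
  qed
qed

theorem proposition2p1:
  fixes k :: "('r, 'm) ring_scheme" and A :: "('r, 'a, 'n) module_scheme"
    and star :: "'a \<Rightarrow> 'a \<Rightarrow> 'a" and \<alpha> :: "'a \<Rightarrow> 'a" and c :: 'a
  assumes "left_weakly_unital_hom_assoc_algebra k A star \<alpha> c"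
    and "bij_betw \<alpha> (carrier A) (carrier A)"
  shows "\<exists>dot :: 'a \<Rightarrow> 'a \<Rightarrow> 'a.
    left_unital_assoc_algebra k A dot c \<and> generalized_yau_twist k A dot \<alpha> star"
proof -
  interpret left_weakly_unital_hom_assoc_algebra k A star \<alpha> c
    by (fact assms(1))
  define \<beta> where "\<beta> = inv_into (carrier A) \<alpha>"
  define dot where "dot x y = \<beta> (star x y)" for x y
  have \<alpha>_closed: "\<alpha> x \<in> carrier A" if "x \<in> carrier A" for x
    using assms(2) that by (rule bij_betw_apply)
  have \<beta>_closed: "\<beta> x \<in> carrier A" if "x \<in> carrier A" for x
    unfolding \<beta>_def using bij_betw_inv_into[OF assms(2)] that by (rule bij_betw_apply)
  have \<alpha>\<beta>: "\<alpha> (\<beta> x) = x" if "x \<in> carrier A" for x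
    unfolding \<beta>_def using assms(2) that by (rule bij_betw_inv_into_right)
  have \<beta>\<alpha>: "\<beta> (\<alpha> x) = x" if "x \<in> carrier A" for x
    unfolding \<beta>_def using assms(2) that by (rule bij_betw_inv_into_left)
  have star_closed: "star x y \<in> carrier A" if "x \<in> carrier A" "y \<in> carrier A" for x y
    using bilinear that by (auto simp: bilinear_product_def linear_endo_def)
  have \<alpha>_dot: "\<alpha> (dot x y) = star x y" if "x \<in> carrier A" "y \<in> carrier A" for x y
    using that by (simp add: dot_def \<alpha>\<beta> star_closed)
  interpret dot: twisted_associative "carrier A" dot \<alpha> \<beta> c
  proof
    show "dot c x = x" if "x \<in> carrier A" for x
      using that weak_left_unit[of x] \<beta>\<alpha>[of x] by (simp add: dot_def)
    show "dot (\<alpha> x) (\<alpha> (dot y z)) = dot (\<alpha> (dot x y)) (\<alpha> z)"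
      if "x \<in> carrier A" "y \<in> carrier A" "z \<in> carrier A" for x y z
      using that hom_assoc[of x y z] by (simp add: \<alpha>_dot dot_def[of "\<alpha> x"] dot_def[of _ "\<alpha> z"])
  qed (auto simp: dot_def \<alpha>_closed \<beta>_closed star_closed \<alpha>\<beta> \<beta>\<alpha> weak_unit_closed)
  have "linear_endo k A \<beta>"
    using twist_linear \<beta>_closed \<alpha>\<beta> \<beta>\<alpha> by (rule linear_endo_inverse)
  then have comp: "linear_endo k A (\<lambda>x. \<beta> (f x))" if "linear_endo k A f" for f
    using that by (rule linear_endo_comp)
  have "bilinear_product k A dot"
    unfolding bilinear_product_def dot_def
    using bilinear by (intro conjI ballI comp) (simp_all add: bilinear_product_def)
  then interpret dot: nonassoc_algebra k A dot
    by unfold_locales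
  have "left_unital_assoc_algebra k A dot c"
  proof
    show "dot x (dot y z) = dot (dot x y) z"
      if "x \<in> carrier A" "y \<in> carrier A" "z \<in> carrier A" for x y z
      using that by (rule dot.dot_assoc)
    show "c \<in> carrier A"
      by (rule weak_unit_closed)
    show "dot c x = x" if "x \<in> carrier A" for x
      using that by (rule dot.c_dot)
  qed
  moreover have "generalized_yau_twist k A dot \<alpha> star"
  proof
    show "linear_endo k A \<alpha>"
      by (rule twist_linear)
    show "\<alpha> (dot (\<alpha> x) (\<alpha> (dot y z))) = \<alpha> (dot (\<alpha> (dot x y)) (\<alpha> z))"
      if "x \<in> carrier A" "y \<in> carrier A" "z \<in> carrier A" for x y z
      using that by (rule arg_cong[OF dot.twisted_assoc])
    show "star x y = \<alpha> (dot x y)" if "x \<in> carrier A" "y \<in> carrier A" for x y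
      using that by (rule \<alpha>_dot [symmetric])
  qed
  ultimately show ?thesis
    by blast
qed

end
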